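(* Let $K<N$ be a positive integer. Let $\mathcal P\subseteq\mathbb R^N$ be an irreducible, closed, convex and CP admissible set whose conic hull is $\mathrm{cone}(\mathcal P)=\mathbb R_{\mathcal L_1}\times(\mathbb R_+)_{\mathcal L_+}\times(\mathbb R_-)_{\mathcal L_-}$, where $\mathcal L_1,\mathcal L_+,\mathcal L_-$ form a disjoint union of $\{1,\dots,N\}$, and let $A\in\mathbb R^{m\times N}$ have unit columns. Suppose there exist constants $\delta_{K,\mathcal P}$ of Property RI on $\mathcal P$ and $\theta_{K,\mathcal P}$ of Property RO on $\mathcal P$ corresponding to $\mathcal L_1,\mathcal L_+,\mathcal L_-$ such that for any index set $\mathcal J$ and any $u,v\in\mathcal P$ with $\mathrm{supp}(v)\subseteq\mathcal J\subsetneq\mathrm{supp}(u)$, the following conditions hold: (C1) $\mathcal L_0(u,v)$ is empty, $u_j>0$ for all $j\in\mathcal L_a^0(u,v)$, and $u_j<0$ for all $j\in\mathcal L_b^0(u,v)$; and (C2) $$(1-\delta_{K,\mathcal P})\cdot\min\Big(\min_{j\in\mathcal L_a^-(u,v)}\sqrt{a_j(v)/\widetilde t_j(u,v)},\ 1,\ \min_{j\in\mathcal L_b^+(u,v)}\sqrt{b_j(v)/\widetilde t_j(u,v)}\Big)>\sqrt K\cdot\theta_{K,\mathcal P}.$$ Then condition $(\mathbf H)$ holds on $\mathcal P$.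
   Context: Notation: $A_{\bullet j}$ is the $j$th column of $A$ (unit columns: $\|A_{\bullet j}\|_2=1$ for all $j$); $\mathrm{supp}(x)=\{i:x_i\ne0\}$; $\Sigma_K=\{x\in\mathbb R^N:|\mathrm{supp}(x)|\le K\}$; $c_+=\max(c,0)$, $c_-=\max(-c,0)$; $\mathbf e_j$ is the $j$th standard basis vector; $S^c$ is the complement in $\{1,\dots,N\}$; $\mathcal U_{\mathcal I}$ denotes a factor $\mathcal U$ for each coordinate in $\mathcal I$; $\mathrm{cone}(\mathcal P)$ is the set of nonnegative combinations of finitely many vectors of $\mathcal P$. Minima/maxima over empty index sets are omitted. CP admissible: a nonempty $\mathcal P\subseteq\mathbb R^N$ such that for any $x\in\mathcal P$ and any $\mathcal J\subseteq\mathrm{supp}(x)$ (possibly empty), the vector obtained from $x$ by setting the coordinates outside $\mathcal J$ to $0$ lies in $\mathcal P$. A closed, convex, CP admissible $\mathcal P$ is irreducible if no coordinate $i$ satisfies $\{x_i:x\in\mathcal P\}=\{0\}$. For $v\in\mathcal P$, $\mathbb I_j(v):=\{t\in\mathbb R: v+t\mathbf e_j\in\mathcal P\}$ is a closed interval containing $0$, with endpoints $a_j(v)=\inf\mathbb I_j(v)\in\mathbb R_-\cup\{-\infty\}$ and $b_j(v)=\sup\mathbb I_j(v)\in\mathbb R_+\cup\{+\infty\}$. For $u,v\in\mathcal P$: $\widetilde t_j(u,v):=\langle A(u-v),A_{\bullet j}\rangle/\|A_{\bullet j}\|_2^2$ and $f_j^*(u,v):=\min_{t\in\mathbb I_j(v)}\|Au-A(v+t\mathbf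 e_j)\|_2^2$. For an index set $\mathcal J$ and $u,v\in\mathcal P$ with $\mathrm{supp}(v)\subseteq\mathcal J\subsetneq\mathrm{supp}(u)$, define the following subsets of $\mathrm{supp}(u)\setminus\mathcal J$ (they depend on $\mathcal J$): $\mathcal L_a^-(u,v)=\{j:\widetilde t_j(u,v)<a_j(v)<0\}$; $\mathcal L_a^0(u,v)=\{j:\widetilde t_j(u,v)\le b_j(v),\ a_j(v)=0<b_j(v)\}$; $\mathcal L_b^+(u,v)=\{j:\widetilde t_j(u,v)>b_j(v)>0\}$; $\mathcal L_b^0(u,v)=\{j:\widetilde t_j(u,v)\ge a_j(v),\ a_j(v)<0=b_j(v)\}$; $\mathcal L_0(u,v)=\{j:a_j(v)=0=b_j(v)\}$. A real $\delta$ is of Property RI on $\mathcal P$ if $0<\delta<1$ and $(1-\delta)\|u-v\|_2^2\le\|A(u-v)\|_2^2$ for all $u,v\in\Sigma_K\cap\mathcal P$ with $\mathrm{supp}(v)\subsetneq\mathrm{supp}(u)$. A real $\theta$ is of Property RO on $\mathcal P$ corresponding to $\mathcal S_1,\mathcal S_+,\mathcal S_-$ (disjoint with union $\{1,\dots,N\}$) if $\theta>0$ and for all $u,v\in\Sigma_K\cap\mathcal P$ with $\mathrm{supp}(v)\subsetneq\mathrm{supp}(u)$, $$\max\Big(\max_{j\in[\mathrm{supp}(u)]^c\cap\mathcal S_1}|\langle A(u-v),A_{\bullet j}\rangle|,\ \max_{j\in[\mathrm{supp}(u)]^c\cap\mathcal S_+}\langle A(u-v),A_{\bullet j}\rangle_+,\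 \max_{j\in[\mathrm{supp}(u)]^c\cap\mathcal S_-}\langle A(u-v),A_{\bullet j}\rangle_-\Big)\le\theta\|u-v\|_2.$$ Condition $(\mathbf H)$ on $\mathcal P$: for any $0\ne u\in\Sigma_K\cap\mathcal P$, any index set $\mathcal J\subsetneq\mathrm{supp}(u)$ (possibly empty), and an arbitrary optimal solution $v$ of $\min\{\|A(u-w)\|_2^2:w\in\mathcal P,\ \mathrm{supp}(w)\subseteq\mathcal J\}$, one has $\min_{j\in\mathrm{supp}(u)\setminus\mathcal J}f_j^*(u,v)<\min_{j\in[\mathrm{supp}(u)]^c}f_j^*(u,v)$. *)

theory Defs
  imports "HOL-Analysis.Analysis"
begin

text \<open>
  \<open>\<real>\<^sup>N\<close> is \<open>real ^ 'n\<close> with \<open>N = CARD('n)\<close>, and an \<open>m \<times> N\<close> matrix is an element of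
  \<open>real ^ 'n ^ 'm\<close>.
\<close>

definition supp :: "real ^ 'n \<Rightarrow> 'n set" where
  "supp x = {i. x $ i \<noteq> 0}"

definition sparse :: "nat \<Rightarrow> (real ^ 'n) set" where
  "sparse K = {x. card (supp x) \<le> K}"

definition CP_admissible :: "(real ^ 'n) set \<Rightarrow> bool" where
  "CP_admissible P \<longleftrightarrow> P \<noteq> {} \<and>
     (\<forall>x\<in>P. \<forall>J. J \<subseteq> supp x \<longrightarrow> (\<chi> i. if i \<in> J then x $ i else 0) \<in> P)"

definition irreducible_set :: "(real ^ 'n) set \<Rightarrow> bool" where
  "irreducible_set P \<longleftrightarrow> \<not> (\<exists>i. (\<lambda>x. x $ i) ` P = {0})"

text \<open>Finite nonnegative combinations; this is the library's \<open>convex_cone hull\<close>, not its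
  \<open>conic hull\<close>, which only rescales single vectors.\<close>

definition nonneg_span :: "(real ^ 'n) set \<Rightarrow> (real ^ 'n) set" where
  "nonneg_span P = {\<Sum>x\<in>F. c x *\<^sub>R x | F c. finite F \<and> F \<subseteq> P \<and> (\<forall>x\<in>F. 0 \<le> c x)}"

lemma nonneg_span_eq_convex_cone_hull: "nonneg_span P = convex_cone hull P"
proof
  show "nonneg_span P \<subseteq> convex_cone hull P"
  proof
    fix y assume "y \<in> nonneg_span P"
    then obtain F c where F: "finite F" "F \<subseteq> P" "\<forall>x\<in>F. 0 \<le> c x"
      and y: "y = (\<Sum>x\<in>F. c x *\<^sub>R x)"
      unfolding nonneg_span_def by blast
    from F have "(\<Sum>x\<in>F. c x *\<^sub>R x) \<in> convex_cone hull P"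
      by (induction F rule: finite_induct)
        (auto intro!: convex_cone_hull_add convex_cone_hull_mul convex_cone_hull_contains_0
           intro: hull_inc)
    with y show "y \<in> convex_cone hull P" by simp
  qed
next
  have inc: "P \<subseteq> nonneg_span P"
  proof
    fix x assume "x \<in> P"
    then show "x \<in> nonneg_span P"
      unfolding nonneg_span_def
      by (intro CollectI exI[of _ "{x}"] exI[of _ "\<lambda>_. 1::real"]) auto
  qed
  have add: "x + y \<in> nonneg_span P" if x: "x \<in> nonneg_span P" and y: "y \<in> nonneg_span P" for x y
  proof -
    obtain F c where F: "finite F" "F \<subseteq> P" "\<forall>x\<in>F. 0 \<le> c x" "x = (\<Sum>x\<in>F. c x *\<^sub>R x)"
      using x unfolding nonneg_span_def by blast
    obtain G d where G: "finite G" "G \<subseteq> P" "\<forall>x\<in>G. 0 \<le> d x" "y = (\<Sum>x\<in>G. d x *\<^sub>R x)"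
      using y unfolding nonneg_span_def by blast
    let ?c = "\<lambda>z. if z \<in> F then c z else 0" and ?d = "\<lambda>z. if z \<in> G then d z else 0"
    have "x = (\<Sum>z\<in>F \<union> G. ?c z *\<^sub>R z)"
      using F G by (auto intro!: sum.mono_neutral_cong_left)
    moreover have "y = (\<Sum>z\<in>F \<union> G. ?d z *\<^sub>R z)"
      using F G by (auto intro!: sum.mono_neutral_cong_left)
    ultimately have "x + y = (\<Sum>z\<in>F \<union> G. (?c z + ?d z) *\<^sub>R z)"
      by (simp add: scaleR_add_left sum.distrib)
    moreover have "finite (F \<union> G)" "F \<union> G \<subseteq> P" "\<forall>z\<in>F \<union> G. 0 \<le> ?c z + ?d z"
      using F G by auto
    ultimately show ?thesis
      unfolding nonneg_span_def
      by (intro CollectI exI[of _ "F \<union> G"] exI[of _ "\<lambda>z. ?c z + ?d z"] conjI)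
  qed
  have scale: "a *\<^sub>R x \<in> nonneg_span P" if x: "x \<in> nonneg_span P" and a: "0 \<le> a" for x a
  proof -
    obtain F c where F: "finite F" "F \<subseteq> P" "\<forall>x\<in>F. 0 \<le> c x" "x = (\<Sum>x\<in>F. c x *\<^sub>R x)"
      using x unfolding nonneg_span_def by blast
    then have "a *\<^sub>R x = (\<Sum>z\<in>F. (a * c z) *\<^sub>R z)"
      by (simp add: scaleR_sum_right)
    with F a show ?thesis
      unfolding nonneg_span_def
      by (intro CollectI exI[of _ F] exI[of _ "\<lambda>z. a * c z"]) auto
  qed
  have "0 \<in> nonneg_span P"
    unfolding nonneg_span_def by (intro CollectI exI[of _ "{}"]) auto
  with add scale have "convex_cone (nonneg_span P)"
    unfolding convex_cone_iff by blast
  with inc show "convex_cone hull P \<subseteq> nonneg_span P"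
    by (rule hull_minimal)
qed

text \<open>\<open>\<real>\<^bsub>L1\<^esub> \<times> (\<real>\<^sub>+)\<^bsub>Lp\<^esub> \<times> (\<real>\<^sub>-)\<^bsub>Lm\<^esub>\<close>, for index sets that partition the coordinates;
  the factors \<open>\<real>\<^bsub>L1\<^esub>\<close> impose no constraint.\<close>

definition orthant_product :: "'n set \<Rightarrow> 'n set \<Rightarrow> 'n set \<Rightarrow> (real ^ 'n) set" where
  "orthant_product L1 Lp Lm =
     {x. (\<forall>i\<in>L1. x $ i \<in> UNIV) \<and> (\<forall>i\<in>Lp. x $ i \<in> {0..}) \<and> (\<forall>i\<in>Lm. x $ i \<in> {..0})}"

definition index_partition :: "'n set \<Rightarrow> 'n set \<Rightarrow> 'n set \<Rightarrow> bool" where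
  "index_partition L1 Lp Lm \<longleftrightarrow>
     L1 \<inter> Lp = {} \<and> L1 \<inter> Lm = {} \<and> Lp \<inter> Lm = {} \<and> L1 \<union> Lp \<union> Lm = UNIV"

definition steps :: "(real ^ 'n) set \<Rightarrow> 'n \<Rightarrow> real ^ 'n \<Rightarrow> real set" where
  "steps P j v = {t. v + t *\<^sub>R axis j 1 \<in> P}"

text \<open>The endpoints of the step interval may be infinite, hence extended reals.\<close>

definition lower_end :: "(real ^ 'n) set \<Rightarrow> 'n \<Rightarrow> real ^ 'n \<Rightarrow> ereal" where
  "lower_end P j v = (INF t\<in>steps P j v. ereal t)"

definition upper_end :: "(real ^ 'n) set \<Rightarrow> 'n \<Rightarrow> real ^ 'n \<Rightarrow> ereal" where
  "upper_end P j v = (SUP t\<in>steps P j v. ereal t)"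

definition free_step :: "real ^ 'n ^ 'm \<Rightarrow> 'n \<Rightarrow> real ^ 'n \<Rightarrow> real ^ 'n \<Rightarrow> real" where
  "free_step A j u v = (A *v (u - v)) \<bullet> column j A / (norm (column j A))\<^sup>2"

text \<open>For \<open>v \<in> P\<close>, \<open>P\<close> closed and convex, the step interval is nonempty and closed, so the
  infimum of this quadratic in \<open>t\<close> (bounded below by \<open>0\<close>) is attained: it is the minimum.\<close>

definition f_star ::
  "real ^ 'n ^ 'm \<Rightarrow> (real ^ 'n) set \<Rightarrow> 'n \<Rightarrow> real ^ 'n \<Rightarrow> real ^ 'n \<Rightarrow> real" where
  "f_star A P j u v =
     (INF t\<in>steps P j v. (norm (A *v u - A *v (v + t *\<^sub>R axis j 1)))\<^sup>2)"

definition La_minus ::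
  "real ^ 'n ^ 'm \<Rightarrow> (real ^ 'n) set \<Rightarrow> 'n set \<Rightarrow> real ^ 'n \<Rightarrow> real ^ 'n \<Rightarrow> 'n set" where
  "La_minus A P J u v = {j \<in> supp u - J.
     ereal (free_step A j u v) < lower_end P j v \<and> lower_end P j v < 0}"

definition La_zero ::
  "real ^ 'n ^ 'm \<Rightarrow> (real ^ 'n) set \<Rightarrow> 'n set \<Rightarrow> real ^ 'n \<Rightarrow> real ^ 'n \<Rightarrow> 'n set" where
  "La_zero A P J u v = {j \<in> supp u - J.
     ereal (free_step A j u v) \<le> upper_end P j v \<and>
     lower_end P j v = 0 \<and> 0 < upper_end P j v}"

definition Lb_plus ::
  "real ^ 'n ^ 'm \<Rightarrow> (real ^ 'n) set \<Rightarrow> 'n set \<Rightarrow> real ^ 'n \<Rightarrow> real ^ 'n \<Rightarrow> 'n set" where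
  "Lb_plus A P J u v = {j \<in> supp u - J.
     ereal (free_step A j u v) > upper_end P j v \<and> upper_end P j v > 0}"

definition Lb_zero ::
  "real ^ 'n ^ 'm \<Rightarrow> (real ^ 'n) set \<Rightarrow> 'n set \<Rightarrow> real ^ 'n \<Rightarrow> real ^ 'n \<Rightarrow> 'n set" where
  "Lb_zero A P J u v = {j \<in> supp u - J.
     ereal (free_step A j u v) \<ge> lower_end P j v \<and>
     lower_end P j v < 0 \<and> upper_end P j v = 0}"

definition L_zero ::
  "(real ^ 'n) set \<Rightarrow> 'n set \<Rightarrow> real ^ 'n \<Rightarrow> real ^ 'n \<Rightarrow> 'n set" where
  "L_zero P J u v = {j \<in> supp u - J. lower_end P j v = 0 \<and> upper_end P j v = 0}"

definition property_RI ::
  "nat \<Rightarrow> real ^ 'n ^ 'm \<Rightarrow> (real ^ 'n) set \<Rightarrow> real \<Rightarrow> bool" where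
  "property_RI K A P \<delta> \<longleftrightarrow> 0 < \<delta> \<and> \<delta> < 1 \<and>
     (\<forall>u \<in> sparse K \<inter> P. \<forall>v \<in> sparse K \<inter> P. supp v \<subset> supp u \<longrightarrow>
        (1 - \<delta>) * (norm (u - v))\<^sup>2 \<le> (norm (A *v (u - v)))\<^sup>2)"

text \<open>The three maxima are merged into one maximum over a union, so that an empty index set
  contributes nothing. The union is nonempty when \<open>K < N\<close> and the three index sets cover
  all coordinates.\<close>

definition property_RO ::
  "nat \<Rightarrow> real ^ 'n ^ 'm \<Rightarrow> (real ^ 'n) set \<Rightarrow> 'n set \<Rightarrow> 'n set \<Rightarrow> 'n set \<Rightarrow> real \<Rightarrow> bool" where
  "property_RO K A P S1 Sp Sm \<theta> \<longleftrightarrow> 0 < \<theta> \<and>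
     (\<forall>u \<in> sparse K \<inter> P. \<forall>v \<in> sparse K \<inter> P. supp v \<subset> supp u \<longrightarrow>
        Max ((\<lambda>j. \<bar>(A *v (u - v)) \<bullet> column j A\<bar>) ` (- supp u \<inter> S1)
           \<union> (\<lambda>j. max ((A *v (u - v)) \<bullet> column j A) 0) ` (- supp u \<inter> Sp)
           \<union> (\<lambda>j. max (- ((A *v (u - v)) \<bullet> column j A)) 0) ` (- supp u \<inter> Sm))
        \<le> \<theta> * norm (u - v))"

text \<open>On \<open>La_minus\<close> and \<open>Lb_plus\<close> the relevant endpoint lies strictly between \<open>0\<close> and the
  real \<open>free_step\<close>, so it is finite and \<open>real_of_ereal\<close> loses nothing.\<close>

definition step_ratio ::
  "real ^ 'n ^ 'm \<Rightarrow> (real ^ 'n) set \<Rightarrow> 'n set \<Rightarrow> real ^ 'n \<Rightarrow> real ^ 'n \<Rightarrow> real" where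
  "step_ratio A P J u v = Min (
       (\<lambda>j. sqrt (real_of_ereal (lower_end P j v) / free_step A j u v)) ` La_minus A P J u v
     \<union> {1}
     \<union> (\<lambda>j. sqrt (real_of_ereal (upper_end P j v) / free_step A j u v)) ` Lb_plus A P J u v)"

definition condition_H :: "nat \<Rightarrow> real ^ 'n ^ 'm \<Rightarrow> (real ^ 'n) set \<Rightarrow> bool" where
  "condition_H K A P \<longleftrightarrow>
     (\<forall>u \<in> sparse K \<inter> P. u \<noteq> 0 \<longrightarrow>
       (\<forall>J v. J \<subset> supp u \<longrightarrow>
          is_arg_min (\<lambda>w. (norm (A *v (u - w)))\<^sup>2) (\<lambda>w. w \<in> P \<and> supp w \<subseteq> J) v \<longrightarrow>
          Min ((\<lambda>j. f_star A P j u v) ` (supp u - J))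
            < Min ((\<lambda>j. f_star A P j u v) ` (- supp u))))"

end

theory Submission
  imports Defs
begin

text \<open>
  Write \<open>g = A (u - v)\<close> and \<open>g\<^sub>j = \<langle>g, A\<^sub>j\<rangle>\<close>. As the columns are unit vectors, the step \<open>t\<close> along
  coordinate \<open>j\<close> decreases the objective by \<open>2 t g\<^sub>j - t\<^sup>2\<close>. Off the support of \<open>u\<close> the sign
  constraints and Property RO bound every decrease by \<open>(\<theta> \<parallel>u - v\<parallel>)\<^sup>2\<close>. Suppose the same bound held
  on \<open>supp u - J\<close>. Choosing \<open>t\<close> as the projection of \<open>g\<^sub>j\<close> onto the step interval, (C1) and the
  ratio \<open>\<rho>\<close> in (C2) then give \<open>\<rho> u\<^sub>j g\<^sub>j \<le> \<bar>u\<^sub>j\<bar> \<theta> \<parallel>u - v\<parallel>\<close>. The restriction of \<open>u\<close> to \<open>J\<close> is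
  feasible, so optimality of \<open>v\<close> gives \<open>\<parallel>g\<parallel>\<^sup>2 \<le> \<Sum>\<^bsub>j \<in> supp u - J\<^esub> u\<^sub>j g\<^sub>j\<close>. With
  Property RI and Cauchy-Schwarz, \<open>\<rho> (1 - \<delta>) \<parallel>u - v\<parallel>\<^sup>2 \<le> \<surd>K \<theta> \<parallel>u - v\<parallel>\<^sup>2\<close>, contradicting (C2).
\<close>

section \<open>Step intervals and their extended-real endpoints\<close>

text \<open>By convexity and \<open>0 \<in> S\<close>, a missing \<open>t\<close> lies strictly
  above all of \<open>S\<close>. Closedness makes \<open>Sup S\<close> a member of \<open>S\<close>,
  so the supremum itself would be below \<open>t\<close>.\<close>

lemma le_SUP_ereal_imp_mem:
  fixes S :: "real set"
  assumes "closed S" "convex S" "0 \<in> S" "0 \<le> t" "ereal t \<le> (SUP s\<in>S. ereal s)"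
  shows "t \<in> S"
proof (rule ccontr)
  assume t: "t \<notin> S"
  have less: "s < t" if "s \<in> S" for s
  proof (rule ccontr)
    assume "\<not> s < t"
    moreover have "is_interval S" using \<open>convex S\<close> by (simp add: is_interval_convex_1)
    ultimately show False
      using mem_is_interval_1_I[of S 0 s t] that assms t by auto
  qed
  have bdd: "bdd_above S" using less by (meson bdd_above.I less_le)
  have "Sup S \<in> S" using closed_contains_Sup[of S] bdd assms by auto
  moreover have "(SUP s\<in>S. ereal s) \<le> ereal (Sup S)"
    by (rule SUP_least) (simp add: bdd cSup_upper)
  ultimately show False using less[of "Sup S"] assms(5)
    by (metis ereal_less_eq(3) leD order_trans)
qed

text \<open>Reflection through 0 turns the infimum into a supremum.\<close>

lemma INF_ereal_le_imp_mem:
  fixes S :: "real set"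
  assumes "closed S" "convex S" "0 \<in> S" "t \<le> 0" "(INF s\<in>S. ereal s) \<le> ereal t"
  shows "t \<in> S"
proof -
  have "(SUP s\<in>uminus ` S. ereal s) = - (INF s\<in>S. ereal s)"
    unfolding ereal_SUP_uminus_eq[symmetric] by (simp add: image_image)
  then have "ereal (- t) \<le> (SUP s\<in>uminus ` S. ereal s)"
    using assms(5) by (simp add: ereal_uminus_le_reorder flip: uminus_ereal.simps(1))
  from le_SUP_ereal_imp_mem[OF _ _ _ _ this] have "- t \<in> uminus ` S"
    using assms(1-4) closed_negations convex_negations by auto
  then show ?thesis by auto
qed

lemma zero_mem_steps: "v \<in> P \<Longrightarrow> 0 \<in> steps P j v"
  by (simp add: steps_def)

lemma closed_steps: "closed P \<Longrightarrow> closed (steps P j v)"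
  unfolding steps_def
  by (rule continuous_closed_vimage[unfolded vimage_def]) (auto intro!: continuous_intros)

lemma convex_steps:
  assumes "convex P" shows "convex (steps P j v)"
proof (rule convexI)
  fix x y a b :: real
  assume h: "x \<in> steps P j v" "y \<in> steps P j v" "0 \<le> a" "0 \<le> b" "a + b = 1"
  then have "a *\<^sub>R (v + x *\<^sub>R axis j 1) + b *\<^sub>R (v + y *\<^sub>R axis j 1) \<in> P"
    using assms by (auto simp: steps_def intro: convexD)
  moreover have "a *\<^sub>R (v + x *\<^sub>R axis j 1) + b *\<^sub>R (v + y *\<^sub>R axis j 1)
      = (a + b) *\<^sub>R v + (a * x + b * y) *\<^sub>R axis j 1"
    by (simp add: algebra_simps)
  ultimately show "a *\<^sub>R x + b *\<^sub>R y \<in> steps P j v"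
    using h by (simp add: steps_def)
qed

section \<open>Gain of a single coordinate step\<close>

text \<open>The unit column makes the coefficient of \<open>t\<^sup>2\<close> equal to one. The
  subtracted bracket is the gain of the step, the quantity bounded from here on.\<close>

lemma norm_residual_step:
  fixes A :: "real ^ 'n ^ 'm"
  assumes "norm (column j A) = 1"
  shows "(norm (A *v u - A *v (v + t *\<^sub>R axis j 1)))\<^sup>2
    = (norm (A *v (u - v)))\<^sup>2 - (2 * t * ((A *v (u - v)) \<bullet> column j A) - t\<^sup>2)"
proof -
  have eq: "A *v u - A *v (v + t *\<^sub>R axis j 1) = A *v (u - v) - t *\<^sub>R column j A"
    by (simp add: matrix_vector_right_distrib matrix_vector_mult_diff_distrib
        matrix_vector_mult_scaleR matrix_vector_mult_basis)
  have "column j A \<bullet> column j A = 1"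
    using assms by (simp add: dot_square_norm)
  then show ?thesis
    unfolding eq power2_norm_eq_inner
    by (simp add: inner_diff_left inner_diff_right power2_eq_square
        inner_commute algebra_simps)
qed

lemma f_star_le:
  fixes A :: "real ^ 'n ^ 'm"
  assumes "norm (column j A) = 1" "t \<in> steps P j v"
  shows "f_star A P j u v
    \<le> (norm (A *v (u - v)))\<^sup>2 - (2 * t * ((A *v (u - v)) \<bullet> column j A) - t\<^sup>2)"
  unfolding f_star_def norm_residual_step[OF assms(1), symmetric]
  by (rule cINF_lower[OF _ assms(2)]) (auto intro!: bdd_belowI[of _ 0])

lemma f_star_ge:
  fixes A :: "real ^ 'n ^ 'm"
  assumes "norm (column j A) = 1" "v \<in> P"
    and "\<And>t. t \<in> steps P j v \<Longrightarrow> 2 * t * ((A *v (u - v)) \<bullet> column j A) - t\<^sup>2 \<le> c"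
  shows "(norm (A *v (u - v)))\<^sup>2 - c \<le> f_star A P j u v"
  unfolding f_star_def norm_residual_step[OF assms(1)]
proof (rule cINF_greatest)
  show "steps P j v \<noteq> {}" using zero_mem_steps[OF assms(2)] by blast
next
  fix t assume "t \<in> steps P j v"
  from assms(3)[OF this] show "(norm (A *v (u - v)))\<^sup>2 - c
      \<le> (norm (A *v (u - v)))\<^sup>2 - (2 * t * ((A *v (u - v)) \<bullet> column j A) - t\<^sup>2)"
    by linarith
qed

lemma step_ratio_le:
  fixes A :: "real ^ 'n ^ 'm"
  shows "step_ratio A P J u v \<le> 1"
    and "j \<in> La_minus A P J u v \<Longrightarrow>
      step_ratio A P J u v \<le> sqrt (real_of_ereal (lower_end P j v) / free_step A j u v)"
    and "j \<in> Lb_plus A P J u v \<Longrightarrow>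
      step_ratio A P J u v \<le> sqrt (real_of_ereal (upper_end P j v) / free_step A j u v)"
  unfolding step_ratio_def by (auto intro!: Min_le)

section \<open>Correlations on the support of \<open>u\<close>\<close>

text \<open>When \<open>u $ j * g j u v\<close> is positive, the gain is tested at the feasible step
  nearest to \<open>g j u v\<close>. Either this is \<open>g j u v\<close> itself, so its modulus is
  at most \<open>c\<close>, or it is an endpoint \<open>e\<close>, and then
  \<open>sqrt (e / g j u v)\<close> times that modulus is at most \<open>c\<close>. The ratio is
  below both factors. (C1) excludes \<open>e = 0\<close>, where the gain would carry no
  information.\<close>

lemma gain_bound_imp_correlation_bound:
  fixes A :: "real ^ 'n ^ 'm"
  defines "g \<equiv> \<lambda>j u v. (A *v (u - v)) \<bullet> column j A"
  assumes P: "closed P" "convex P" "v \<in> P" and unit: "norm (column j A) = 1"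
    and j: "j \<in> supp u - J"
    and C1: "L_zero P J u v = {}" "\<forall>j\<in>La_zero A P J u v. u $ j > 0"
      "\<forall>j\<in>Lb_zero A P J u v. u $ j < 0"
    and rho: "0 \<le> step_ratio A P J u v" and c: "0 \<le> c"
    and gain: "\<And>t. t \<in> steps P j v \<Longrightarrow> 2 * t * g j u v - t\<^sup>2 \<le> c\<^sup>2"
  shows "step_ratio A P J u v * (u $ j * g j u v) \<le> \<bar>u $ j\<bar> * c"
proof (cases "0 < u $ j * g j u v")
  case False
  \<comment> \<open>The left side is nonpositive here, because the ratio is nonnegative.\<close>
  with rho c show ?thesis
    by (meson abs_ge_zero linorder_not_less mult_nonneg_nonneg mult_nonneg_nonpos order_trans)
next
  case True
  let ?g = "g j u v" and ?r = "step_ratio A P J u v" and ?S = "steps P j v"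
  note S = closed_steps[OF P(1), of j v] convex_steps[OF P(2), of j v] zero_mem_steps[OF P(3), of j]
  have free: "free_step A j u v = ?g" by (simp add: free_step_def g_def unit)
  have up0: "0 \<le> upper_end P j v" unfolding upper_end_def
    by (rule SUP_upper2[OF S(3)]) simp
  have low0: "lower_end P j v \<le> 0" unfolding lower_end_def
    by (rule INF_lower2[OF S(3)]) simp
  have mem_up: "t \<in> ?S" if "0 \<le> t" "ereal t \<le> upper_end P j v" for t
    using le_SUP_ereal_imp_mem S that unfolding upper_end_def by blast
  have mem_low: "t \<in> ?S" if "t \<le> 0" "lower_end P j v \<le> ereal t" for t
    using INF_ereal_le_imp_mem S that unfolding lower_end_def by blast
  have full: "?r * \<bar>?g\<bar> \<le> c" if "?g \<in> ?S"
  proof -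
    have "?g\<^sup>2 \<le> c\<^sup>2" using gain[OF that] by (simp add: power2_eq_square)
    then have "\<bar>?g\<bar> \<le> c" using c by (metis abs_le_square_iff abs_of_nonneg)
    moreover have "?r * \<bar>?g\<bar> \<le> 1 * \<bar>?g\<bar>"
      by (rule mult_right_mono[OF step_ratio_le(1)]) simp
    ultimately show ?thesis by simp
  qed
  \<comment> \<open>At an endpoint \<open>e\<close> between \<open>0\<close> and \<open>g\<^sub>j\<close> the gain \<open>2 e g\<^sub>j - e\<^sup>2\<close> is at least \<open>e g\<^sub>j\<close>.\<close>
  have clipped: "?r * \<bar>?g\<bar> \<le> c"
    if e: "e \<in> ?S" "?r \<le> sqrt (e / ?g)" "0 \<le> e * (?g - e)" for e
  proof -
    have g0: "?g \<noteq> 0" using True by auto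
    have "e * ?g \<le> c\<^sup>2" using gain[OF e(1)] e(3) by (simp add: power2_eq_square algebra_simps)
    moreover have "sqrt (e / ?g) * \<bar>?g\<bar> = sqrt (e * ?g)"
    proof -
      have "sqrt (e / ?g) * \<bar>?g\<bar> = sqrt (e / ?g) * sqrt (?g\<^sup>2)" by simp
      also have "\<dots> = sqrt (e / ?g * ?g\<^sup>2)" by (rule real_sqrt_mult[symmetric])
      also have "e / ?g * ?g\<^sup>2 = e * ?g" using g0 by (simp add: power2_eq_square)
      finally show ?thesis .
    qed
    ultimately have "sqrt (e / ?g) * \<bar>?g\<bar> \<le> c"
      using c by (metis real_sqrt_le_mono real_sqrt_abs abs_of_nonneg)
    moreover have "?r * \<bar>?g\<bar> \<le> sqrt (e / ?g) * \<bar>?g\<bar>"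
      by (rule mult_right_mono[OF e(2)]) simp
    ultimately show ?thesis by simp
  qed
  have nz: "\<not> (lower_end P j v = 0 \<and> upper_end P j v = 0)"
    using C1(1) j by (auto simp: L_zero_def)
  have "?r * \<bar>?g\<bar> \<le> c"
  proof (cases "0 < ?g")
    case pos: True
    then have u: "0 < u $ j" using True by (simp add: zero_less_mult_iff)
    show ?thesis
    proof (cases "ereal ?g \<le> upper_end P j v")
      case True
      with pos show ?thesis by (intro full mem_up) auto
    next
      case False
      \<comment> \<open>A zero endpoint would put \<open>j\<close> into \<open>Lb_zero\<close>,
        whose sign condition contradicts \<open>0 < u $ j\<close>.\<close>
      have "upper_end P j v \<noteq> 0"
      proof
        assume up: "upper_end P j v = 0"
        with nz low0 have low: "lower_end P j v < 0" by auto
        moreover have "lower_end P j v \<le> ereal ?g"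
          using low pos by (meson ereal_less(2) less_imp_le order_trans)
        ultimately have "j \<in> Lb_zero A P J u v"
          using j up by (simp add: Lb_zero_def free)
        with C1(3) u show False by force
      qed
      with up0 have up: "0 < upper_end P j v" by auto
      \<comment> \<open>The endpoint is finite, being positive and below the real number
        \<open>?g\<close>.\<close>
      then obtain b where b: "upper_end P j v = ereal b" "0 < b" "b < ?g"
        using False by (cases "upper_end P j v") auto
      have "j \<in> Lb_plus A P J u v" using j b by (simp add: Lb_plus_def free)
      from step_ratio_le(3)[OF this] b show ?thesis
        by (intro clipped[of b] mem_up) (auto simp: free)
    qed
  next
    case False
    with True have neg: "?g < 0" and u: "u $ j < 0"
      by (auto simp: zero_less_mult_iff)
    show ?thesis
    proof (cases "lower_end P j v \<le> ereal ?g")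
      case True
      with neg show ?thesis by (intro full mem_low) auto
    next
      case False
      \<comment> \<open>Mirror image: a zero endpoint would put \<open>j\<close> into
        \<open>La_zero\<close> and force \<open>0 < u $ j\<close>.\<close>
      have "lower_end P j v \<noteq> 0"
      proof
        assume low: "lower_end P j v = 0"
        with nz up0 have up: "0 < upper_end P j v" by auto
        moreover have "ereal ?g \<le> upper_end P j v"
          using up neg by (meson ereal_less(1) less_imp_le order_trans)
        ultimately have "j \<in> La_zero A P J u v"
          using j low by (simp add: La_zero_def free)
        with C1(2) u show False by force
      qed
      with low0 have low: "lower_end P j v < 0" by auto
      then obtain a where a: "lower_end P j v = ereal a" "a < 0" "?g < a"
        using False by (cases "lower_end P j v") auto
      have "j \<in> La_minus A P J u v" using j a by (simp add: La_minus_def free)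
      from step_ratio_le(2)[OF this] a show ?thesis
        by (intro clipped[of a] mem_low) (auto simp: free intro: mult_nonpos_nonpos)
    qed
  qed
  then have "\<bar>u $ j\<bar> * (?r * \<bar>?g\<bar>) \<le> \<bar>u $ j\<bar> * c" by (rule mult_left_mono) simp
  moreover have "u $ j * ?g = \<bar>u $ j\<bar> * \<bar>?g\<bar>" using True by (metis abs_mult abs_of_pos)
  ultimately show ?thesis by (simp add: mult.left_commute)
qed

section \<open>Gains off the support of \<open>u\<close>\<close>

lemma orthant_sign:
  assumes "nonneg_span P = orthant_product L1 Lp Lm" "x \<in> P"
  shows "i \<in> Lp \<Longrightarrow> 0 \<le> x $ i" "i \<in> Lm \<Longrightarrow> x $ i \<le> 0"
proof -
  have "x \<in> orthant_product L1 Lp Lm"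
    using assms hull_inc nonneg_span_eq_convex_cone_hull by metis
  then show "i \<in> Lp \<Longrightarrow> 0 \<le> x $ i" "i \<in> Lm \<Longrightarrow> x $ i \<le> 0"
    by (auto simp: orthant_product_def)
qed

text \<open>Since \<open>v $ j = 0\<close>, the step \<open>t\<close> is itself the
  \<open>j\<close>th coordinate of a point of \<open>P\<close> and inherits the sign prescribed by
  the cone. Either Property RO controls the modulus of the correlation, or \<open>t\<close> points
  against the correlation and gains nothing.\<close>

lemma off_support_gain_bound:
  fixes A :: "real ^ 'n ^ 'm"
  defines "g \<equiv> \<lambda>j u v. (A *v (u - v)) \<bullet> column j A"
  assumes RO: "property_RO K A P L1 Lp Lm \<theta>" and part: "index_partition L1 Lp Lm"
    and cone: "nonneg_span P = orthant_product L1 Lp Lm"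
    and uv: "u \<in> sparse K \<inter> P" "v \<in> sparse K \<inter> P" "supp v \<subset> supp u"
    and j: "j \<notin> supp u" and t: "t \<in> steps P j v"
  shows "2 * t * g j u v - t\<^sup>2 \<le> (\<theta> * norm (u - v))\<^sup>2"
proof -
  let ?g = "g j u v" and ?c = "\<theta> * norm (u - v)"
  let ?M = "(\<lambda>j. \<bar>g j u v\<bar>) ` (- supp u \<inter> L1)
           \<union> (\<lambda>j. max (g j u v) 0) ` (- supp u \<inter> Lp)
           \<union> (\<lambda>j. max (- g j u v) 0) ` (- supp u \<inter> Lm)"
  have c0: "0 \<le> ?c" using RO by (simp add: property_RO_def)
  have "Max ?M \<le> ?c" using RO uv unfolding property_RO_def g_def by blast
  then have M: "x \<le> ?c" if "x \<in> ?M" for x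
    using that Max_ge[of ?M x] by (meson finite finite_UnI finite_imageI order_trans)
  have vj: "v $ j = 0" using uv(3) j by (auto simp: supp_def)
  have mem: "v + t *\<^sub>R axis j 1 \<in> P" using t by (simp add: steps_def)
  have val: "(v + t *\<^sub>R axis j 1) $ j = t" using vj by (simp add: axis_def)
  \<comment> \<open>Over all real \<open>t\<close>, the gain is largest at
    \<open>t = ?g\<close>.\<close>
  have sq: "2 * t * ?g - t\<^sup>2 \<le> ?g\<^sup>2"
    using zero_le_power2[of "t - ?g"] by (simp add: power2_eq_square algebra_simps)
  consider "j \<in> L1" | "j \<in> Lp" | "j \<in> Lm"
    using part unfolding index_partition_def by blast
  then have "\<bar>?g\<bar> \<le> ?c \<or> t * ?g \<le> 0"
  proof cases
    case 1
    then have "\<bar>?g\<bar> \<in> ?M" using j by auto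
    then show ?thesis using M by blast
  next
    case 2
    then have "max ?g 0 \<in> ?M" using j by auto
    then have "max ?g 0 \<le> ?c" by (rule M)
    moreover have "0 \<le> t" using orthant_sign(1)[OF cone mem 2] val by simp
    ultimately show ?thesis by (cases "0 \<le> ?g") (auto intro: mult_nonneg_nonpos)
  next
    case 3
    then have "max (- ?g) 0 \<in> ?M" using j by auto
    then have "max (- ?g) 0 \<le> ?c" by (rule M)
    moreover have "t \<le> 0" using orthant_sign(2)[OF cone mem 3] val by simp
    ultimately show ?thesis by (cases "0 \<le> ?g") (auto intro: mult_nonpos_nonneg)
  qed
  then show ?thesis
  proof
    assume "\<bar>?g\<bar> \<le> ?c"
    then have "?g\<^sup>2 \<le> ?c\<^sup>2" using c0 by (metis abs_le_square_iff abs_of_nonneg)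
    with sq show ?thesis by linarith
  next
    assume "t * ?g \<le> 0"
    then have "2 * t * ?g - t\<^sup>2 \<le> 0" using zero_le_power2[of t] by linarith
    then show ?thesis using zero_le_power2[of ?c] by linarith
  qed
qed

section \<open>First-order optimality of \<open>v\<close>\<close>

text \<open>Moving from \<open>v\<close> towards \<open>w\<close> preserves feasibility by
  convexity; a positive inner product would make a short move of this kind reduce the
  residual.\<close>

lemma arg_min_inner_le:
  fixes A :: "real ^ 'n ^ 'm"
  assumes "convex P" "is_arg_min (\<lambda>w. (norm (A *v (u - w)))\<^sup>2) (\<lambda>w. w \<in> P \<and> supp w \<subseteq> J) v"
    and w: "w \<in> P" "supp w \<subseteq> J"
  shows "(A *v (u - v)) \<bullet> (A *v (w - v)) \<le> 0"
proof (rule ccontr)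
  assume "\<not> ?thesis"
  then have "(A *v u - A *v v) \<bullet> (A *v w - A *v v) > 0"
    by (simp add: matrix_vector_mult_diff_distrib)
  from closer_point_lemma[OF this] obtain s where
    s: "0 < s" "s \<le> 1" "dist (A *v v + s *\<^sub>R (A *v w - A *v v)) (A *v u) < dist (A *v v) (A *v u)"
    by blast
  let ?x = "v + s *\<^sub>R (w - v)"
  have v: "v \<in> P" "supp v \<subseteq> J" using assms(2) by (auto simp: is_arg_min_def)
  have "?x = (1 - s) *\<^sub>R v + s *\<^sub>R w" by (simp add: algebra_simps)
  then have "?x \<in> P" using s v w assms(1) convexD_alt[of P v w s] by simp
  moreover have "supp ?x \<subseteq> J"
  proof
    fix i assume "i \<in> supp ?x"
    then have "v $ i \<noteq> 0 \<or> w $ i \<noteq> 0" by (auto simp: supp_def)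
    then show "i \<in> J" using v w by (auto simp: supp_def)
  qed
  ultimately have "\<not> (norm (A *v (u - ?x)))\<^sup>2 < (norm (A *v (u - v)))\<^sup>2"
    using assms(2) by (auto simp: is_arg_min_def)
  moreover have "A *v (u - ?x) = A *v u - (A *v v + s *\<^sub>R (A *v w - A *v v))"
    by (simp add: matrix_vector_right_distrib matrix_vector_mult_diff_distrib
        matrix_vector_mult_scaleR)
  moreover have "A *v (u - v) = A *v u - A *v v"
    by (simp add: matrix_vector_mult_diff_distrib)
  ultimately show False
    using s(3) by (simp add: dist_norm norm_minus_commute power_strict_mono)
qed

lemma inner_matrix_vector_mult:
  fixes A :: "real ^ 'n ^ 'm"
  shows "y \<bullet> (A *v x) = (\<Sum>j\<in>UNIV. x $ j * (y \<bullet> column j A))"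
  by (simp add: matrix_mult_sum scalar_mult_eq_scaleR inner_sum_right)

text \<open>With \<open>w\<close> the restriction of \<open>u\<close> to \<open>J\<close>, split
  \<open>u - v\<close> into \<open>u - w\<close> and \<open>w - v\<close>. Optimality makes the
  second contribution nonpositive, and \<open>u - w\<close> lives on
  \<open>supp u - J\<close>.\<close>

lemma arg_min_residual_le:
  fixes A :: "real ^ 'n ^ 'm"
  assumes "convex P" "CP_admissible P" "u \<in> P" "J \<subseteq> supp u"
    and opt: "is_arg_min (\<lambda>w. (norm (A *v (u - w)))\<^sup>2) (\<lambda>w. w \<in> P \<and> supp w \<subseteq> J) v"
  shows "(norm (A *v (u - v)))\<^sup>2
    \<le> (\<Sum>j\<in>supp u - J. u $ j * ((A *v (u - v)) \<bullet> column j A))"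
proof -
  define w where "w = (\<chi> i. if i \<in> J then u $ i else 0)"
  let ?g = "A *v (u - v)"
  have "w \<in> P" using assms(2-4) by (auto simp: CP_admissible_def w_def)
  moreover have "supp w \<subseteq> J" by (auto simp: supp_def w_def)
  ultimately have "?g \<bullet> (A *v (w - v)) \<le> 0"
    by (rule arg_min_inner_le[OF assms(1) opt])
  moreover have "A *v (u - v) = A *v (u - w) + A *v (w - v)"
    by (simp flip: matrix_vector_right_distrib)
  then have "(norm ?g)\<^sup>2 = ?g \<bullet> (A *v (u - w)) + ?g \<bullet> (A *v (w - v))"
    by (metis inner_add_right power2_norm_eq_inner)
  moreover have "?g \<bullet> (A *v (u - w)) = (\<Sum>j\<in>supp u - J. u $ j * (?g \<bullet> column j A))"
    unfolding inner_matrix_vector_mult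
    by (rule sum.mono_neutral_cong_right) (auto simp: w_def supp_def)
  ultimately show ?thesis by simp
qed

text \<open>Cauchy-Schwarz against the all-ones vector on \<open>S\<close>; this is the source of
  the factor \<open>sqrt K\<close>.\<close>

lemma sum_abs_le_sqrt_card_norm:
  fixes x :: "real ^ 'n"
  shows "(\<Sum>j\<in>S. \<bar>x $ j\<bar>) \<le> sqrt (real (card S)) * norm x"
proof -
  have "(\<Sum>j\<in>S. \<bar>x $ j\<bar>) \<le> L2_set (\<lambda>_. 1) S * L2_set (\<lambda>j. x $ j) S"
    using L2_set_mult_ineq[of "\<lambda>_. 1" "\<lambda>j. x $ j" S] by simp
  also have "L2_set (\<lambda>_. 1::real) S = sqrt (real (card S))" by (simp add: L2_set_def)
  also have "L2_set (\<lambda>j. x $ j) S \<le> norm x"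
    unfolding norm_vec_def L2_set_def by (auto intro!: sum_mono2)
  finally show ?thesis by (simp add: mult_left_mono)
qed

section \<open>Combining the bounds into condition (H)\<close>

theorem theorem6p1:
  fixes A :: "real ^ 'n ^ 'm" and P :: "(real ^ 'n) set"
    and K :: nat and L1 Lp Lm :: "'n set"
  assumes "0 < K" and "K < CARD('n)"
    and "closed P" and "convex P" and "CP_admissible P" and "irreducible_set P"
    and "index_partition L1 Lp Lm"
    and "nonneg_span P = orthant_product L1 Lp Lm"
    and "\<forall>j. norm (column j A) = 1"
    and "\<exists>\<delta> \<theta>. property_RI K A P \<delta> \<and> property_RO K A P L1 Lp Lm \<theta> \<and>
      (\<forall>J. \<forall>u\<in>P. \<forall>v\<in>P. supp v \<subseteq> J \<and> J \<subset> supp u \<longrightarrow>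
        (L_zero P J u v = {} \<and> (\<forall>j\<in>La_zero A P J u v. u $ j > 0) \<and>
         (\<forall>j\<in>Lb_zero A P J u v. u $ j < 0)) \<and>
        (1 - \<delta>) * step_ratio A P J u v > sqrt (real K) * \<theta>)"
  shows "condition_H K A P"
  unfolding condition_H_def
proof (intro ballI impI allI)
  fix u J v
  assume u: "u \<in> sparse K \<inter> P" and J: "J \<subset> supp u"
    and opt: "is_arg_min (\<lambda>w. (norm (A *v (u - w)))\<^sup>2) (\<lambda>w. w \<in> P \<and> supp w \<subseteq> J) v"
  obtain \<delta> \<theta> where RI: "property_RI K A P \<delta>" and RO: "property_RO K A P L1 Lp Lm \<theta>"
    and C: "\<forall>J. \<forall>u\<in>P. \<forall>v\<in>P. supp v \<subseteq> J \<and> J \<subset> supp u \<longrightarrow>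
        (L_zero P J u v = {} \<and> (\<forall>j\<in>La_zero A P J u v. u $ j > 0) \<and>
         (\<forall>j\<in>Lb_zero A P J u v. u $ j < 0)) \<and>
        (1 - \<delta>) * step_ratio A P J u v > sqrt (real K) * \<theta>"
    using assms(10) by (elim exE conjE) (rule that)
  have unit: "norm (column j A) = 1" for j using assms(9) by blast
  have v: "v \<in> P" "supp v \<subseteq> J" using opt by (auto simp: is_arg_min_def)
  have suppvu: "supp v \<subset> supp u" using v J by blast
  have cardu: "card (supp u) \<le> K" using u by (simp add: sparse_def)
  have vK: "v \<in> sparse K \<inter> P"
  proof -
    have "card (supp v) \<le> card (supp u)" using suppvu by (intro card_mono) auto
    with v(1) cardu show ?thesis by (simp add: sparse_def)
  qed
  have "u \<in> P" using u by simp
  from C[rule_format, OF this v(1) conjI[OF v(2) J]]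
  have CC: "L_zero P J u v = {}" "\<forall>j\<in>La_zero A P J u v. u $ j > 0"
    "\<forall>j\<in>Lb_zero A P J u v. u $ j < 0"
    "(1 - \<delta>) * step_ratio A P J u v > sqrt (real K) * \<theta>"
    by simp_all
  let ?g = "A *v (u - v)" and ?r = "step_ratio A P J u v"
  define c where "c = \<theta> * norm (u - v)"
  have \<theta>: "0 < \<theta>" using RO by (simp add: property_RO_def)
  have \<delta>: "0 < 1 - \<delta>" using RI by (simp add: property_RI_def)
  have "0 \<le> sqrt (real K) * \<theta>" using \<theta> by simp
  \<comment> \<open>The right side of (C2) is nonnegative and \<open>1 - \<delta>\<close> is
    positive.\<close>
  then have r0: "0 < ?r" using CC(4) \<delta> by (smt (verit) zero_less_mult_iff)
  have d0: "0 < norm (u - v)" using suppvu by auto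
  have c0: "0 \<le> c" using \<theta> by (simp add: c_def)
  \<comment> \<open>One gain above \<open>c\<^sup>2\<close> suffices, since off the support no gain
    exceeds \<open>c\<^sup>2\<close>; its strictness separates the two minima.\<close>
  have "\<exists>j\<in>supp u - J. \<exists>t\<in>steps P j v. 2 * t * (?g \<bullet> column j A) - t\<^sup>2 > c\<^sup>2"
  proof (rule ccontr)
    assume "\<not> ?thesis"
    then have gain: "2 * t * (?g \<bullet> column j A) - t\<^sup>2 \<le> c\<^sup>2"
      if "j \<in> supp u - J" "t \<in> steps P j v" for j t
      using that by (auto simp: not_less)
    have "(1 - \<delta>) * (norm (u - v))\<^sup>2 \<le> (norm ?g)\<^sup>2"
      using RI u vK suppvu unfolding property_RI_def by blast
    also have "\<dots> \<le> (\<Sum>j\<in>supp u - J. u $ j * (?g \<bullet> column j A))"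
      using J by (intro arg_min_residual_le[OF assms(4,5) \<open>u \<in> P\<close> _ opt]) auto
    finally have "?r * ((1 - \<delta>) * (norm (u - v))\<^sup>2)
        \<le> ?r * (\<Sum>j\<in>supp u - J. u $ j * (?g \<bullet> column j A))"
      using r0 by simp
    also have "\<dots> \<le> (\<Sum>j\<in>supp u - J. \<bar>u $ j\<bar> * c)"
      unfolding sum_distrib_left
    proof (rule sum_mono)
      fix j assume j: "j \<in> supp u - J"
      show "?r * (u $ j * (?g \<bullet> column j A)) \<le> \<bar>u $ j\<bar> * c"
        by (rule gain_bound_imp_correlation_bound[OF assms(3,4) v(1) unit j CC(1-3)
              less_imp_le[OF r0] c0 gain[OF j]])
    qed
    \<comment> \<open>\<open>v\<close> vanishes outside \<open>J\<close>, so \<open>u\<close> and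
      \<open>u - v\<close> agree on these coordinates.\<close>
    also have "\<dots> = (\<Sum>j\<in>supp u - J. \<bar>(u - v) $ j\<bar>) * c"
      unfolding sum_distrib_right using v(2) by (intro sum.cong) (force simp: supp_def)+
    also have "\<dots> \<le> (sqrt (real (card (supp u - J))) * norm (u - v)) * c"
      by (rule mult_right_mono[OF sum_abs_le_sqrt_card_norm c0])
    also have "\<dots> \<le> (sqrt (real K) * norm (u - v)) * c"
    proof -
      have "card (supp u - J) \<le> K"
        using cardu card_mono[of "supp u" "supp u - J"] by auto
      then show ?thesis using c0 by (intro mult_right_mono) auto
    qed
    also have "\<dots> = (sqrt (real K) * \<theta>) * (norm (u - v))\<^sup>2"
      by (simp add: c_def power2_eq_square)
    finally have "((1 - \<delta>) * ?r) * (norm (u - v))\<^sup>2 \<le> (sqrt (real K) * \<theta>) * (norm (u - v))\<^sup>2"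
      by (simp add: mult_ac)
    with d0 CC(4) show False by simp
  qed
  then obtain j t where jt: "j \<in> supp u - J" "t \<in> steps P j v"
    "2 * t * (?g \<bullet> column j A) - t\<^sup>2 > c\<^sup>2" by blast
  have "Min ((\<lambda>j. f_star A P j u v) ` (supp u - J)) \<le> f_star A P j u v"
    using jt by (intro Min_le) auto
  also have "\<dots> < (norm ?g)\<^sup>2 - c\<^sup>2"
    using f_star_le[OF unit jt(2), of u] jt(3) by linarith
  also have "\<dots> \<le> Min ((\<lambda>j. f_star A P j u v) ` (- supp u))"
  proof -
    \<comment> \<open>Sparsity with \<open>K < N\<close> leaves a coordinate off the support, so the
      right-hand minimum is over a nonempty set.\<close>
    have "supp u \<noteq> UNIV" using cardu assms(2) by auto
    then have "- supp u \<noteq> {}" by blast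
    moreover have "(norm ?g)\<^sup>2 - c\<^sup>2 \<le> f_star A P j u v" if "j \<in> - supp u" for j
      unfolding c_def using that
      by (intro f_star_ge unit v(1) off_support_gain_bound[OF RO assms(7,8) u vK suppvu]) auto
    ultimately show ?thesis by (subst Min_ge_iff) auto
  qed
  finally show "Min ((\<lambda>j. f_star A P j u v) ` (supp u - J))
      < Min ((\<lambda>j. f_star A P j u v) ` (- supp u))" .
qed

end
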